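(* Let $V_0,V_1,\dots$ be indeterminates and let $\boldsymbol{\lambda}=(\lambda_i)_{i\ge1}$ be given by $\lambda_i=V_{i-1}^{-1}V_i^{-1}$. Then for all positive integers $n$ and $k$, \[ \mu^{\le 2k-1}_{-2n}(\mathbf{0},\boldsymbol{\lambda})=V_0\sum_{\pi\in\mathrm{PV}^{2,2k-1}_{2n-1}}\mathrm{wt}(\pi). \]
   Context: $\mathbf{0}=(0,0,\dots)$. A Motzkin path is a finite sequence of points in $\mathbb{Z}\times\mathbb{Z}_{\ge0}$ whose steps are each $(1,1)$, $(1,0)$ or $(1,-1)$; for sequences $\mathbf{b}=(b_i)_{i\ge0}$, $\boldsymbol{\lambda}$ its weight is the product of $b_i$ over horizontal steps starting at height $i$ and $\lambda_i$ over down steps starting at height $i$. $\mu^{\le K}_N(\mathbf{b},\boldsymbol{\lambda})$ ($N\ge0$) is the sum of weights of Motzkin paths from $(0,0)$ to $(N,0)$ staying weakly below $y=K$. If $(f_N)_{N\ge0}$ satisfies $f_N=c_1f_{N-1}+\cdots+c_df_{N-d}$ for all $N\ge d$ with $c_d\ne0$, it is extended uniquely to all $N\in\mathbb{Z}$ so that the recurrence holds for all $N$; $\mu^{\le K}_{-N}$ denotes this extension (it exists here). The weight of a sequence $(a_1,\dots,a_N)$ is $V_{a_1}\cdots V_{a_N}$. A $2$-peak-valley sequence is a sequence $(a_1,\dots,a_N)$ of nonnegative integers such that, with $a_0=a_{N+1}=0$, each even $a_i$ satisfies $a_{i-1}>a_i<a_{i+1}$ and each odd $a_i$ satisfies $a_{i-1}<a_i>a_{i+1}$;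 $\mathrm{PV}^{2,K}_N$ is the set of those of length $N$ with all entries in $\{0,\dots,K\}$. *)

theory Defs
  imports
    "HOL-Library.Poly_Mapping"
    "HOL-Computational_Algebra.Fraction_Field"
begin

section \<open>Indeterminates\<close>

text \<open>
  Polynomials over \<open>'c\<close> in countably many indeterminates are finitely supported maps from
  exponent vectors \<open>nat \<Rightarrow>\<^sub>0 nat\<close> to coefficients, multiplied by convolution; since the
  indeterminates have to be inverted, we work in the field of fractions.
\<close>

type_synonym 'c ratfun = "((nat \<Rightarrow>\<^sub>0 nat) \<Rightarrow>\<^sub>0 'c) fract"

definition indet :: "nat \<Rightarrow> 'c::idom ratfun" where
  "indet i = Fraction_Field.Fract (Poly_Mapping.single (Poly_Mapping.single i 1) 1) 1"


section \<open>Bounded Motzkin paths\<close>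

text \<open>A path is the list of its points, so a path with \<open>N\<close> steps has \<open>N + 1\<close> points.\<close>

definition motzkin_step :: "int \<times> nat \<Rightarrow> int \<times> nat \<Rightarrow> bool" where
  "motzkin_step p q \<longleftrightarrow>
     fst q = fst p + 1 \<and> (snd q = snd p + 1 \<or> snd q = snd p \<or> snd p = snd q + 1)"

definition motzkin_path :: "(int \<times> nat) list \<Rightarrow> bool" where
  "motzkin_path ps \<longleftrightarrow> ps \<noteq> [] \<and> successively motzkin_step ps"

definition step_weight ::
    "(nat \<Rightarrow> 'a) \<Rightarrow> (nat \<Rightarrow> 'a) \<Rightarrow> int \<times> nat \<Rightarrow> int \<times> nat \<Rightarrow> 'a::comm_ring_1" where
  "step_weight b l p q =
     (if snd q = snd p then b (snd p) else if snd q < snd p then l (snd p) else 1)"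

definition path_weight ::
    "(nat \<Rightarrow> 'a) \<Rightarrow> (nat \<Rightarrow> 'a) \<Rightarrow> (int \<times> nat) list \<Rightarrow> 'a::comm_ring_1" where
  "path_weight b l ps = (\<Prod>i<length ps - 1. step_weight b l (ps ! i) (ps ! Suc i))"

definition bounded_paths :: "nat \<Rightarrow> nat \<Rightarrow> (int \<times> nat) list set" where
  "bounded_paths K N =
     {ps. motzkin_path ps \<and> hd ps = (0, 0) \<and> last ps = (int N, 0) \<and> (\<forall>p\<in>set ps. snd p \<le> K)}"

text \<open>
  Down steps start at height at least 1, so the value \<open>l 0\<close> is never used.
\<close>

definition bounded_moment ::
    "nat \<Rightarrow> (nat \<Rightarrow> 'a) \<Rightarrow> (nat \<Rightarrow> 'a) \<Rightarrow> nat \<Rightarrow> 'a::comm_ring_1" where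
  "bounded_moment K b l N = (\<Sum>ps\<in>bounded_paths K N. path_weight b l ps)"


section \<open>Extension of linear recurrences to negative indices\<close>

definition recurrence_extension :: "(nat \<Rightarrow> 'a::field) \<Rightarrow> (int \<Rightarrow> 'a) \<Rightarrow> bool" where
  "recurrence_extension f g \<longleftrightarrow>
     (\<exists>d c. 1 \<le> d \<and> c d \<noteq> 0 \<and>
        (\<forall>N\<ge>d. f N = (\<Sum>j=1..d. c j * f (N - j))) \<and>
        (\<forall>N. g (int N) = f N) \<and>
        (\<forall>N. g N = (\<Sum>j=1..d. c j * g (N - int j))))"

definition bounded_moment_ext ::
    "nat \<Rightarrow> (nat \<Rightarrow> 'a) \<Rightarrow> (nat \<Rightarrow> 'a) \<Rightarrow> int \<Rightarrow> 'a::field" where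
  "bounded_moment_ext K b l = (THE g. recurrence_extension (bounded_moment K b l) g)"

text \<open>
  The extension depends only on the sequence, not on the recurrence it is computed from.
\<close>

lemma recurrence_backward_zero:
  fixes u :: "int \<Rightarrow> 'a::field"
  assumes d: "1 \<le> d" and cd: "c d \<noteq> 0"
    and rec: "\<And>N. u N = (\<Sum>j=1..d. c j * u (N - int j))"
    and zero: "\<And>N. N \<ge> M \<Longrightarrow> u N = 0"
  shows "u N = 0"
proof -
  have "\<forall>N\<ge>M - int k. u N = 0" for k
  proof (induction k)
    case 0
    then show ?case using zero by simp
  next
    case (Suc k)
    have "u N = 0" if N: "N = M - int k - 1" for N
    proof -
      have "0 = u (N + int d)"
        using Suc N d by simp
      also have "\<dots> = (\<Sum>j=1..d. c j * u (N + int d - int j))"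
        by (rule rec)
      also have "\<dots> = (\<Sum>j=1..d. if j = d then c d * u N else 0)"
        using Suc N by (intro sum.cong) auto
      also have "\<dots> = c d * u N"
        using d by simp
      finally show ?thesis using cd by simp
    qed
    with Suc show ?case
      by (smt (verit) of_nat_Suc)
  qed
  from this[of "nat (M - N)"] show ?thesis by simp
qed

lemma recurrence_extension_unique:
  assumes "recurrence_extension f g" and "recurrence_extension f h"
  shows "g = h"
proof -
  obtain d c where d: "1 \<le> d" "c d \<noteq> 0" and gf: "\<And>N. g (int N) = f N"
    and g: "\<And>N. g N = (\<Sum>j=1..d. c j * g (N - int j))"
    using assms(1) unfolding recurrence_extension_def by blast
  obtain e c' where e: "1 \<le> e" "c' e \<noteq> 0" and hf: "\<And>N. h (int N) = f N"
    and h: "\<And>N. h N = (\<Sum>j=1..e. c' j * h (N - int j))"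
    using assms(2) unfolding recurrence_extension_def by blast
  define u where "u N = g N - (\<Sum>j=1..e. c' j * g (N - int j))" for N
  have eq: "g N = h N" if "N \<ge> 0" for N
    using gf[of "nat N"] hf[of "nat N"] that by simp
  have urec: "u N = (\<Sum>j=1..d. c j * u (N - int j))" for N
  proof -
    have "(\<Sum>i=1..e. c' i * g (N - int i)) =
        (\<Sum>i=1..e. c' i * (\<Sum>j=1..d. c j * g (N - int i - int j)))"
      by (intro sum.cong refl arg_cong[where f = "\<lambda>x. _ * x"] g)
    also have "\<dots> = (\<Sum>j=1..d. c j * (\<Sum>i=1..e. c' i * g (N - int j - int i)))"
      unfolding sum_distrib_left
      by (subst sum.swap) (intro sum.cong refl, simp add: mult.left_commute diff_right_commute)
    finally show ?thesis
      using g[of N] by (simp only: u_def right_diff_distrib sum_subtractf)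
  qed
  have uzero: "u N = 0" if "N \<ge> int e" for N
  proof -
    have "(\<Sum>j=1..e. c' j * g (N - int j)) = (\<Sum>j=1..e. c' j * h (N - int j))"
      using that by (intro sum.cong) (auto simp: eq)
    then show ?thesis
      using h[of N] eq[of N] that by (simp add: u_def)
  qed
  have u0: "u N = 0" for N
    by (rule recurrence_backward_zero[where u = u, OF d urec uzero])
  have vrec: "g N - h N = (\<Sum>j=1..e. c' j * (g (N - int j) - h (N - int j)))" for N
    using u0[of N] h[of N] by (simp only: u_def right_diff_distrib sum_subtractf) simp
  have vzero: "g N - h N = 0" if "N \<ge> 0" for N
    using eq[OF that] by simp
  have "g N - h N = 0" for N
    by (rule recurrence_backward_zero[where u = "\<lambda>N. g N - h N", OF e vrec vzero])
  then show ?thesis by auto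
qed


section \<open>2-peak-valley sequences\<close>

text \<open>
  \<open>0 # as @ [0]\<close> is the sequence \<open>a\<^sub>0, \<dots>, a\<^bsub>N+1\<^esub>\<close> with the boundary values added.
\<close>

definition peak_valley2 :: "nat list \<Rightarrow> bool" where
  "peak_valley2 as \<longleftrightarrow>
     (let a = (\<lambda>i. (0 # as @ [0]) ! i) in
       \<forall>i\<in>{1..length as}.
         (even (a i) \<longrightarrow> a (i - 1) > a i \<and> a i < a (i + 1)) \<and>
         (odd (a i) \<longrightarrow> a (i - 1) < a i \<and> a i > a (i + 1)))"

definition PV2 :: "nat \<Rightarrow> nat \<Rightarrow> nat list set" where
  "PV2 K N = {as. length as = N \<and> set as \<subseteq> {0..K} \<and> peak_valley2 as}"

definition seq_weight :: "(nat \<Rightarrow> 'a) \<Rightarrow> nat list \<Rightarrow> 'a::comm_ring_1" where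
  "seq_weight V as = (\<Prod>a\<leftarrow>as. V a)"

end

theory Submission
  imports Defs
begin

text \<open>
  For \<open>\<lambda>\<^sub>i = 1 / (V\<^bsub>i-1\<^esub> V\<^sub>i)\<close> the transfer matrix of the bounded Motzkin paths is, after conjugation by
  the diagonal matrix with entries \<open>(-1)\<^bsup>h div 2\<^esup> V\<^sub>1 \<cdots> V\<^sub>h\<close>, the signed adjacency matrix of a path on
  \<open>2k\<close> vertices with row \<open>h\<close> divided by \<open>V\<^sub>h\<close>. Its inverse has entry \<open>V\<^sub>j\<close> at \<open>(i, j)\<close> if one of \<open>i, j\<close> is
  even, the other one is odd and the even one is smaller, and \<open>0\<close> otherwise; so the powers of the inverse
  count peak-valley sequences. The powers of the matrix and of its inverse together form one
  bi-infinite sequence of vectors. The entry at height \<open>h\<close> is a polynomial of degree \<open>h\<close> in the shift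
  applied to the entry at height \<open>0\<close>, and the vanishing of the entry at height \<open>2k\<close> is the
  recurrence that the moments and their extension satisfy.
\<close>

section \<open>Moments by transfer of heights\<close>

text \<open>Recursion on the last step of a path ending at height \<open>h\<close>. Only the new
  height is tested against \<open>K\<close>, because entries above \<open>K\<close> are already
  0.\<close>

primrec moment_to ::
    "nat \<Rightarrow> (nat \<Rightarrow> 'a) \<Rightarrow> (nat \<Rightarrow> 'a) \<Rightarrow> nat \<Rightarrow> nat \<Rightarrow> 'a::comm_ring_1" where
  "moment_to K b l 0 h = (if h = 0 then 1 else 0)"
| "moment_to K b l (Suc N) h =
     (if h \<le> K
      then (if h = 0 then 0 else moment_to K b l N (h - 1)) + b h * moment_to K b l N h
             + l (Suc h) * moment_to K b l N (Suc h)
      else 0)"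

lemma moment_to_above: "K < h \<Longrightarrow> moment_to K b l N h = 0"
  by (cases N) auto

text \<open>The end height is free because deleting the last step of a path that ends at height 0
  may leave another end height.\<close>

definition bounded_paths_to :: "nat \<Rightarrow> nat \<Rightarrow> nat \<Rightarrow> (int \<times> nat) list set" where
  "bounded_paths_to K N h =
     {ps. motzkin_path ps \<and> hd ps = (0, 0) \<and> last ps = (int N, h) \<and> (\<forall>p\<in>set ps. snd p \<le> K)}"

lemma fst_last_motzkin_path:
  "motzkin_path ps \<Longrightarrow> fst (last ps) = fst (hd ps) + int (length ps - 1)"
proof (induction ps)
  case (Cons p ps)
  then show ?case
    by (cases ps) (auto simp: motzkin_path_def motzkin_step_def)
qed (simp add: motzkin_path_def)

lemma bounded_paths_to_above: "K < h \<Longrightarrow> bounded_paths_to K N h = {}"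
  using last_in_set by (fastforce simp: bounded_paths_to_def motzkin_path_def)

lemma bounded_paths_to_0: "bounded_paths_to K 0 h = (if h = 0 then {[(0, 0)]} else {})"
proof -
  have "bounded_paths_to K 0 h \<subseteq> (if h = 0 then {[(0, 0)]} else {})"
  proof
    fix ps assume "ps \<in> bounded_paths_to K 0 h"
    then have ps: "ps \<noteq> []" "hd ps = (0, 0)" "last ps = (0, h)" "motzkin_path ps"
      by (auto simp: bounded_paths_to_def motzkin_path_def)
    have "length ps = 1"
      using fst_last_motzkin_path[OF ps(4)] ps(1-3) by (cases ps) (simp_all split: if_splits)
    then obtain p where "ps = [p]"
      by (auto simp: length_Suc_conv)
    with ps show "ps \<in> (if h = 0 then {[(0, 0)]} else {})" by simp
  qed
  moreover have "[(0, 0)] \<in> bounded_paths_to K 0 0"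
    by (simp add: bounded_paths_to_def motzkin_path_def)
  ultimately show ?thesis by (cases "h = 0") auto
qed

lemma bounded_paths_to_Suc:
  assumes "h \<le> K"
  shows "bounded_paths_to K (Suc N) h =
    (\<lambda>ps. ps @ [(int (Suc N), h)]) `
      (\<Union>h'\<in>{h'. h = Suc h' \<or> h = h' \<or> h' = Suc h}. bounded_paths_to K N h')"
  (is "?L = ?f ` ?R")
proof
  show "?L \<subseteq> ?f ` ?R"
  proof
    fix ps assume ps: "ps \<in> ?L"
    then have path: "motzkin_path ps" and hd: "hd ps = (0, 0)"
      and last: "last ps = (int (Suc N), h)" and bd: "\<forall>p\<in>set ps. snd p \<le> K"
      by (auto simp: bounded_paths_to_def)
    obtain qs where qs: "ps = qs @ [(int (Suc N), h)]"
      using path last by (metis append_butlast_last_id motzkin_path_def)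
    have ne: "qs \<noteq> []"
      using hd qs by auto
    obtain i h' where ih: "last qs = (i, h')" by fastforce
    have "motzkin_path qs" "motzkin_step (i, h') (int (Suc N), h)"
      using path ne qs ih by (auto simp: motzkin_path_def successively_append_iff)
    then have "qs \<in> bounded_paths_to K N h'" "h = Suc h' \<or> h = h' \<or> h' = Suc h"
      using hd bd ne qs ih by (auto simp: bounded_paths_to_def motzkin_step_def)
    then show "ps \<in> ?f ` ?R" using qs by blast
  qed
  show "?f ` ?R \<subseteq> ?L"
    using assms
    by (auto simp: bounded_paths_to_def motzkin_path_def motzkin_step_def successively_append_iff)
qed

lemma path_weight_snoc:
  assumes "ps \<noteq> []"
  shows "path_weight b l (ps @ [p]) = path_weight b l ps * step_weight b l (last ps) p"
proof -
  obtain m where m: "length ps = Suc m"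
    using assms by (cases ps) auto
  have "path_weight b l (ps @ [p]) =
      (\<Prod>i<m. step_weight b l (ps ! i) (ps ! Suc i)) * step_weight b l (ps ! m) p"
    unfolding path_weight_def using m by (simp add: nth_append)
  then show ?thesis
    using m assms by (simp add: path_weight_def last_conv_nth)
qed

lemma finite_bounded_paths_to: "finite (bounded_paths_to K N h)"
proof (induction N arbitrary: h)
  case (Suc N)
  have "{h'. h = Suc h' \<or> h = h' \<or> h' = Suc h} \<subseteq> {..Suc h}" by auto
  then have "finite {h'. h = Suc h' \<or> h = h' \<or> h' = Suc h}"
    using finite_subset by blast
  then show ?case
    using Suc by (cases "h \<le> K") (simp_all add: bounded_paths_to_Suc bounded_paths_to_above)
qed (simp add: bounded_paths_to_0)

lemma sum_bounded_paths_to: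
  "(\<Sum>ps\<in>bounded_paths_to K N h. path_weight b l ps) = moment_to K b l N h"
proof (induction N arbitrary: h)
  case 0
  show ?case by (simp add: bounded_paths_to_0 path_weight_def)
next
  case (Suc N)
  show ?case
  proof (cases "h \<le> K")
    case True
    let ?S = "{h'. h = Suc h' \<or> h = h' \<or> h' = Suc h}"
    have S: "?S = (if h = 0 then {h, Suc h} else {h - 1, h, Suc h})" by auto
    have "(\<Sum>ps\<in>bounded_paths_to K (Suc N) h. path_weight b l ps)
        = (\<Sum>ps\<in>(\<Union>h'\<in>?S. bounded_paths_to K N h').
            path_weight b l (ps @ [(int (Suc N), h)]))"
      unfolding bounded_paths_to_Suc[OF True] by (subst sum.reindex) (auto simp: inj_on_def)
    \<comment> \<open>The union is disjoint since the last point of a path records its end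
      height.\<close>
    also have "\<dots> = (\<Sum>h'\<in>?S. \<Sum>ps\<in>bounded_paths_to K N h'.
            path_weight b l (ps @ [(int (Suc N), h)]))"
      by (rule sum.UNION_disjoint)
         (auto simp: finite_bounded_paths_to S, auto simp: bounded_paths_to_def)
    also have "\<dots> = (\<Sum>h'\<in>?S. moment_to K b l N h' *
        step_weight b l (int N, h') (int (Suc N), h))"
      unfolding Suc.IH[symmetric] sum_distrib_right
      by (intro sum.cong refl)
         (auto simp: bounded_paths_to_def motzkin_path_def path_weight_snoc)
    also have "\<dots> = moment_to K b l (Suc N) h"
      using True unfolding S by (cases h) (simp_all add: step_weight_def algebra_simps)
    finally show ?thesis .
  qed (simp add: bounded_paths_to_above)
qed

lemma bounded_moment_eq_moment_to: "bounded_moment K b l N = moment_to K b l N 0"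
  using sum_bounded_paths_to[where h = 0]
  by (simp add: bounded_moment_def bounded_paths_def bounded_paths_to_def)


section \<open>Peak-valley sequences by transfer of values\<close>

definition pv_adj :: "nat \<Rightarrow> nat \<Rightarrow> bool" where
  "pv_adj a b \<longleftrightarrow> even a \<and> odd b \<and> a < b \<or> odd a \<and> even b \<and> b < a"

primrec pv_sum :: "nat \<Rightarrow> (nat \<Rightarrow> 'a) \<Rightarrow> nat \<Rightarrow> nat \<Rightarrow> 'a::comm_ring_1" where
  "pv_sum K V 0 h = (if h = 0 then 1 else 0)"
| "pv_sum K V (Suc n) h = (\<Sum>j | j \<le> K \<and> pv_adj h j. V j * pv_sum K V n j)"

definition pv_walks :: "nat \<Rightarrow> nat \<Rightarrow> nat \<Rightarrow> nat list set" where
  "pv_walks K n h = {as. length as = n \<and> set as \<subseteq> {0..K} \<and> successively pv_adj (h # as @ [0])}"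

lemma finite_pv_walks: "finite (pv_walks K n h)"
  by (rule finite_subset[OF _ finite_lists_length_eq[of "{0..K}" n]]) (auto simp: pv_walks_def)

lemma pv_walks_Suc:
  "pv_walks K (Suc n) h = (\<Union>j\<in>{j. j \<le> K \<and> pv_adj h j}. (#) j ` pv_walks K n j)"
  by (force simp: pv_walks_def length_Suc_conv image_iff)

text \<open>\<open>Suc n\<close> moves lead from \<open>h\<close> to 0. The first \<open>n\<close>
  vertices reached form the sequence; the last one is the appended 0, whose weight is the factor
  \<open>V 0\<close>.\<close>

lemma pv_sum_eq_walks:
  "pv_sum K V (Suc n) h = V 0 * (\<Sum>as\<in>pv_walks K n h. seq_weight V as)"
proof (induction n arbitrary: h)
  case 0
  have "pv_walks K 0 h = (if pv_adj h 0 then {[]} else {})"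
    by (auto simp: pv_walks_def)
  moreover have "pv_sum K V (Suc 0) h =
      (\<Sum>j | j \<le> K \<and> pv_adj h j. if j = 0 then V 0 else 0)"
    unfolding pv_sum.simps by (rule sum.cong) auto
  ultimately show ?case
    by (simp add: seq_weight_def)
next
  case (Suc n)
  have "(\<Sum>as\<in>pv_walks K (Suc n) h. seq_weight V as) =
      (\<Sum>j | j \<le> K \<and> pv_adj h j. \<Sum>as\<in>(#) j ` pv_walks K n j. seq_weight V as)"
    unfolding pv_walks_Suc by (rule sum.UNION_disjoint) (auto simp: finite_pv_walks)
  also have "\<dots> = (\<Sum>j | j \<le> K \<and> pv_adj h j. V j * (\<Sum>as\<in>pv_walks K n j. seq_weight V as))"
    by (simp add: sum.reindex seq_weight_def sum_distrib_left)
  finally show ?case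
    unfolding pv_sum.simps(2)[of K V "Suc n"] Suc.IH
    by (simp add: sum_distrib_left mult.left_commute)
qed

text \<open>Two neighbouring entries of equal parity would each have to exceed, or each be below,
  the other. So parities alternate and the even entry is the smaller one. Nonemptiness matters
  because \<open>pv_adj 0 0\<close> fails.\<close>

lemma peak_valley2_iff_successively:
  assumes "as \<noteq> []"
  shows "peak_valley2 as \<longleftrightarrow> successively pv_adj (0 # as @ [0])"
proof -
  define a where "a = (\<lambda>i. (0 # as @ [0]) ! i)"
  define N where "N = length as"
  have N: "N \<ge> 1" and a0: "a 0 = 0" and aN: "a (Suc N) = 0"
    using assms by (auto simp: N_def a_def nth_append Suc_le_eq)
  have pv: "peak_valley2 as \<longleftrightarrow> (\<forall>i\<in>{1..N}.
      (even (a i) \<longrightarrow> a (i - 1) > a i \<and> a i < a (i + 1)) \<and>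
      (odd (a i) \<longrightarrow> a (i - 1) < a i \<and> a i > a (i + 1)))"
    by (simp add: peak_valley2_def a_def N_def Let_def)
  have walk: "successively pv_adj (0 # as @ [0]) \<longleftrightarrow> (\<forall>i\<le>N. pv_adj (a i) (a (Suc i)))"
    unfolding successively_conv_nth a_def N_def by (simp add: less_Suc_eq_le)
  show ?thesis
  proof
    assume *: "peak_valley2 as"
    have ev: "a (i - 1) > a i \<and> a i < a (i + 1)" if "1 \<le> i" "i \<le> N" "even (a i)" for i
      using * that unfolding pv by auto
    have od: "a (i - 1) < a i \<and> a i > a (i + 1)" if "1 \<le> i" "i \<le> N" "odd (a i)" for i
      using * that unfolding pv by auto
    \<comment> \<open>The padding zeros carry no condition of their own; an entry next to one is
      odd, since an even one would have to be below 0.\<close>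
    have "pv_adj (a i) (a (Suc i))" if "i \<le> N" for i
      using ev[of i] od[of i] ev[of "Suc i"] od[of "Suc i"] a0 aN N that
      by (cases "i = 0"; cases "i = N"; cases "even (a i)"; cases "even (a (Suc i))")
         (auto simp: pv_adj_def)
    then show "successively pv_adj (0 # as @ [0])"
      unfolding walk by simp
  next
    assume *: "successively pv_adj (0 # as @ [0])"
    show "peak_valley2 as"
      unfolding pv
    proof
      fix i assume "i \<in> {1..N}"
      then have "pv_adj (a (i - 1)) (a i)" "pv_adj (a i) (a (i + 1))"
        using *[unfolded walk, rule_format, of "i - 1"] *[unfolded walk, rule_format, of i]
        by auto
      then show "(even (a i) \<longrightarrow> a (i - 1) > a i \<and> a i < a (i + 1)) \<and>
          (odd (a i) \<longrightarrow> a (i - 1) < a i \<and> a i > a (i + 1))"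
        by (auto simp: pv_adj_def)
    qed
  qed
qed

lemma PV2_eq_pv_walks: "N > 0 \<Longrightarrow> PV2 K N = pv_walks K N 0"
  unfolding PV2_def pv_walks_def by (auto simp: peak_valley2_iff_successively)


section \<open>The bi-infinite sequence\<close>

text \<open>In matrix terms: \<open>pv_adj\<close> inverts the signed adjacency matrix of the path \<open>0, \<dots>, K\<close>.\<close>

lemma pv_sum_diff_odd:
  assumes "odd h" "h \<le> K"
  shows "pv_sum K V (Suc n) (h - 1) - pv_sum K V (Suc n) (Suc h) = V h * pv_sum K V n h"
proof -
  \<comment> \<open>An even vertex is adjacent to the larger odd ones, so lowering it by 2 gains
    only the odd \<open>h\<close> in between.\<close>
  have "{j. j \<le> K \<and> pv_adj (h - 1) j} = insert h {j. j \<le> K \<and> pv_adj (Suc h) j}"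
    using assms by (auto simp: pv_adj_def elim!: oddE)
  moreover have "h \<notin> {j. j \<le> K \<and> pv_adj (Suc h) j}" "finite {j. j \<le> K \<and> pv_adj (Suc h) j}"
    using assms by (auto simp: pv_adj_def)
  ultimately show ?thesis by simp
qed

lemma pv_sum_diff_even:
  assumes "even h" "h \<le> K"
  shows "pv_sum K V (Suc n) (Suc h) - (if h = 0 then 0 else pv_sum K V (Suc n) (h - 1)) =
    V h * pv_sum K V n h"
proof (cases "h = 0")
  case True
  have "{j. j \<le> K \<and> pv_adj (Suc 0) j} = {0}"
    by (auto simp: pv_adj_def)
  with True show ?thesis by simp
next
  case False
  \<comment> \<open>An odd vertex is adjacent to the smaller even ones, so raising it by 2 gains
    only the even \<open>h\<close> in between.\<close>
  have "{j. j \<le> K \<and> pv_adj (Suc h) j} = insert h {j. j \<le> K \<and> pv_adj (h - 1) j}"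
    using assms False by (auto simp: pv_adj_def elim!: evenE)
  moreover have "h \<notin> {j. j \<le> K \<and> pv_adj (h - 1) j}" "finite {j. j \<le> K \<and> pv_adj (h - 1) j}"
    using assms by (auto simp: pv_adj_def)
  ultimately show ?thesis using False by simp
qed

text \<open>\<open>Suc K\<close> is even, so its neighbours are odd and larger, hence outside the
  range up to \<open>K\<close>.\<close>

lemma pv_sum_above:
  assumes "odd K"
  shows "pv_sum K V (Suc n) (Suc K) = 0"
proof -
  have "{j. j \<le> K \<and> pv_adj (Suc K) j} = {}"
    using assms by (auto simp: pv_adj_def)
  then show ?thesis by (simp only: pv_sum.simps sum.empty)
qed

definition gauge :: "(nat \<Rightarrow> 'a) \<Rightarrow> nat \<Rightarrow> 'a::field" where
  "gauge V h = (-1) ^ (h div 2) * (\<Prod>i=1..h. V i)"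

definition height_seq :: "nat \<Rightarrow> (nat \<Rightarrow> 'a) \<Rightarrow> (nat \<Rightarrow> 'a) \<Rightarrow> int \<Rightarrow> nat \<Rightarrow> 'a::field" where
  "height_seq K V l N h =
     (if N \<ge> 0 then moment_to K (\<lambda>_. 0) l (nat N) h else gauge V h * pv_sum K V (nat (- N)) h)"

lemma gauge_pv_sum_step:
  fixes V l :: "nat \<Rightarrow> 'a::field"
  assumes nz: "\<And>i. V i \<noteq> 0" and l: "\<And>i. l (Suc i) = inverse (V i) * inverse (V (Suc i))"
    and h: "h \<le> K"
  shows "gauge V h * pv_sum K V n h =
    (if h = 0 then 0 else gauge V (h - 1) * pv_sum K V (Suc n) (h - 1))
      + l (Suc h) * (gauge V (Suc h) * pv_sum K V (Suc n) (Suc h))"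
proof -
  \<comment> \<open>This sign flips exactly on passing from an odd height to the next even one. Both
    neighbours of \<open>h\<close> get the factor \<open>P / V h\<close> up to sign, and the signs
    turn their sum into the difference evaluated by \<open>pv_sum_diff_even\<close> or
    \<open>pv_sum_diff_odd\<close>.\<close>
  let ?\<sigma> = "\<lambda>h. (-1) ^ (h div 2) :: 'a"
  define P where "P = (\<Prod>i=1..h. V i)"
  have up: "l (Suc h) * gauge V (Suc h) = ?\<sigma> (Suc h) * (P / V h)"
    using nz by (simp add: gauge_def P_def l field_simps)
  have down: "gauge V (h - 1) = ?\<sigma> (h - 1) * (P / V h)" if "h \<noteq> 0"
    using nz that by (cases h) (simp_all add: gauge_def P_def)
  have here: "gauge V h = ?\<sigma> h * (P / V h) * V h"
    using nz by (simp add: gauge_def P_def)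
  show ?thesis
  proof (cases "even h")
    case True
    then have "h \<noteq> 0 \<Longrightarrow> h div 2 = Suc ((h - 1) div 2)"
      by presburger
    then have "h \<noteq> 0 \<Longrightarrow> ?\<sigma> (h - 1) = - ?\<sigma> h"
      by simp
    moreover have "?\<sigma> (Suc h) = ?\<sigma> h"
      using True by simp
    ultimately show ?thesis
      using down unfolding here mult.assoc[symmetric] up
      unfolding mult.assoc pv_sum_diff_even[OF True h, symmetric]
      by (auto simp: algebra_simps)
  next
    case False
    then have "?\<sigma> (Suc h) = - ?\<sigma> h" "?\<sigma> (h - 1) = ?\<sigma> h" "h \<noteq> 0"
      by (auto elim!: oddE)
    then show ?thesis
      using down unfolding here mult.assoc[symmetric] up
      unfolding mult.assoc pv_sum_diff_odd[OF False h, symmetric]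
      by (auto simp: algebra_simps)
  qed
qed

lemma height_seq_step:
  fixes V l :: "nat \<Rightarrow> 'a::field"
  assumes nz: "\<And>i. V i \<noteq> 0" and l: "\<And>i. l (Suc i) = inverse (V i) * inverse (V (Suc i))"
    and h: "h \<le> K"
  shows "height_seq K V l (N + 1) h =
    (if h = 0 then 0 else height_seq K V l N (h - 1)) + l (Suc h) * height_seq K V l N (Suc h)"
proof (cases "N \<ge> 0")
  case True
  then show ?thesis using h by (simp add: height_seq_def nat_add_distrib)
next
  case False
  define n where "n = nat (- N - 1)"
  have n: "nat (- N) = Suc n" "nat (- (N + 1)) = n"
    using False by (auto simp: n_def)
  have "height_seq K V l (N + 1) h = gauge V h * pv_sum K V n h"
  \<comment> \<open>At the junction \<open>N = -1\<close> the two halves of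
    \<open>height_seq\<close> agree: at index 0 both are the indicator of height 0, as
    \<open>gauge V 0 = 1\<close>.\<close>
  proof (cases "n = 0")
    case True
    then have "N = -1" using False by (simp add: n_def)
    with True show ?thesis by (simp add: height_seq_def gauge_def)
  next
    case n0: False
    then have "\<not> N + 1 \<ge> 0" by (simp add: n_def)
    then show ?thesis using n by (simp only: height_seq_def if_False)
  qed
  then show ?thesis
    using False gauge_pv_sum_step[of V l h K n, OF nz l h] n
    by (simp only: height_seq_def if_False)
qed

lemma height_seq_above:
  assumes "odd K"
  shows "height_seq K V l N (Suc K) = 0"
proof (cases "N \<ge> 0")
  case False
  then obtain n where "nat (- N) = Suc n"
    by (metis gr0_conv_Suc linorder_not_le neg_0_less_iff_less zero_less_nat_eq)
  then show ?thesis
    using False by (simp only: height_seq_def pv_sum_above[OF assms] if_False mult_zero_right)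
qed (simp add: height_seq_def moment_to_above)


section \<open>The recurrence\<close>

text \<open>Coefficients of the polynomial in the shift that expresses height \<open>h\<close> by height \<open>0\<close>.\<close>

fun shift_coeff :: "(nat \<Rightarrow> 'a) \<Rightarrow> nat \<Rightarrow> nat \<Rightarrow> 'a::field" where
  "shift_coeff l 0 j = (if j = 0 then 1 else 0)"
| "shift_coeff l (Suc 0) j = (if j = 1 then inverse (l 1) else 0)"
| "shift_coeff l (Suc (Suc h)) j =
     inverse (l (Suc (Suc h))) *
       ((if j = 0 then 0 else shift_coeff l (Suc h) (j - 1)) - shift_coeff l h j)"

lemma shift_coeff_above: "h < j \<Longrightarrow> shift_coeff l h j = 0"
  by (induction l h j rule: shift_coeff.induct) auto

lemma shift_coeff_lead: "(\<And>i. l (Suc i) \<noteq> 0) \<Longrightarrow> shift_coeff l h h \<noteq> 0"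
  by (induction h rule: induct_nat_012) (auto simp: shift_coeff_above)

text \<open>Constant terms satisfy a recursion in steps of 2 starting from 1. Nonvanishing at even
  height is what makes the recurrence solvable backwards.\<close>

lemma shift_coeff_const: "(\<And>i. l (Suc i) \<noteq> 0) \<Longrightarrow> shift_coeff l (2 * m) 0 \<noteq> 0"
  by (induction m) auto

text \<open>Solving the transfer step for its top entry gives
  \<open>u N (h + 2) = (u (N + 1) (h + 1) - u N h) / l (h + 2)\<close>, which is the recursion of
  \<open>shift_coeff\<close>.\<close>

lemma sum_shift_coeff:
  fixes u :: "int \<Rightarrow> nat \<Rightarrow> 'a::field"
  assumes nz: "\<And>i. l (Suc i) \<noteq> 0"
    and step: "\<And>N h. h \<le> K \<Longrightarrow>
      u (N + 1) h = (if h = 0 then 0 else u N (h - 1)) + l (Suc h) * u N (Suc h)"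
  shows "h \<le> Suc K \<Longrightarrow> (\<Sum>j\<le>h. shift_coeff l h j * u (N + int j) 0) = u N h"
proof (induction h arbitrary: N rule: induct_nat_012)
  case 0
  then show ?case by simp
next
  case 1
  then show ?case using step[of 0 N] nz[of 0] by simp
next
  case (ge2 h)
  let ?l = "l (Suc (Suc h))"
  have "(\<Sum>j\<le>Suc (Suc h). shift_coeff l (Suc (Suc h)) j * u (N + int j) 0) =
      inverse ?l *
        ((\<Sum>j\<le>Suc (Suc h). (if j = 0 then 0 else shift_coeff l (Suc h) (j - 1)) * u (N + int j) 0)
          - (\<Sum>j\<le>Suc (Suc h). shift_coeff l h j * u (N + int j) 0))"
    by (simp add: sum_distrib_left sum_subtractf[symmetric] algebra_simps
        del: sum.atMost_Suc)
  also have "(\<Sum>j\<le>Suc (Suc h). (if j = 0 then 0 else shift_coeff l (Suc h) (j - 1)) * u (N + int j) 0)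
      = (\<Sum>j\<le>Suc h. shift_coeff l (Suc h) j * u (N + 1 + int j) 0)"
    by (subst sum.atMost_Suc_shift) (simp add: algebra_simps del: sum.atMost_Suc)
  also have "\<dots> = u (N + 1) (Suc h)"
    using ge2.IH(2)[of "N + 1"] ge2.prems by (simp del: sum.atMost_Suc)
  also have "(\<Sum>j\<le>Suc (Suc h). shift_coeff l h j * u (N + int j) 0) = u N h"
    using ge2 by (simp add: shift_coeff_above)
  finally show ?case
    using step[of "Suc h" N] ge2.prems nz[of "Suc h"] by simp
qed

lemma recurrence_extensionI:
  fixes a :: "nat \<Rightarrow> 'a::field"
  assumes d: "1 \<le> d" and a0: "a 0 \<noteq> 0" and ad: "a d \<noteq> 0"
    and gf: "\<And>N. g (int N) = f N"
    and rec: "\<And>N. (\<Sum>j\<le>d. a j * g (N + int j)) = 0"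
  shows "recurrence_extension f g"
proof -
  \<comment> \<open>The annihilating polynomial is solved for its leading term; \<open>c d\<close>
    comes from the constant term \<open>a 0\<close>.\<close>
  define c where "c j = - a (d - j) / a d" for j
  have g: "g N = (\<Sum>j=1..d. c j * g (N - int j))" for N
  proof -
    have "(\<Sum>j=1..d. c j * g (N - int j)) = (\<Sum>j<d. - a j / a d * g (N - int d + int j))"
      by (rule sum.reindex_bij_witness[of _ "\<lambda>j. d - j" "\<lambda>j. d - j"])
         (auto simp: c_def of_nat_diff)
    also have "\<dots> = - (\<Sum>j<d. a j * g (N - int d + int j)) / a d"
      by (simp add: sum_negf sum_divide_distrib)
    also have "(\<Sum>j<d. a j * g (N - int d + int j)) = - a d * g N"
      using rec[of "N - int d"] by (simp add: lessThan_Suc_atMost[symmetric] eq_neg_iff_add_eq_0)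
    finally show ?thesis using ad by simp
  qed
  have "f N = (\<Sum>j=1..d. c j * f (N - j))" if "N \<ge> d" for N
  proof -
    have "f N = (\<Sum>j=1..d. c j * g (int N - int j))"
      using g[of "int N"] gf by simp
    also have "\<dots> = (\<Sum>j=1..d. c j * f (N - j))"
      using that by (intro sum.cong) (auto simp: of_nat_diff[symmetric] gf simp del: of_nat_diff)
    finally show ?thesis .
  qed
  moreover have "c d \<noteq> 0" using a0 ad by (simp add: c_def)
  ultimately show ?thesis
    unfolding recurrence_extension_def using d g gf by blast
qed

lemma bounded_moment_ext_eqI:
  "recurrence_extension (bounded_moment K b l) g \<Longrightarrow> bounded_moment_ext K b l = g"
  unfolding bounded_moment_ext_def
  by (rule the_equality) (auto intro: recurrence_extension_unique)

lemma bounded_moment_ext_eq_height_seq: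
  fixes V l :: "nat \<Rightarrow> 'a::field"
  assumes nz: "\<And>i. V i \<noteq> 0" and l: "\<And>i. l (Suc i) = inverse (V i) * inverse (V (Suc i))"
    and K: "odd K"
  shows "bounded_moment_ext K (\<lambda>_. 0) l = (\<lambda>N. height_seq K V l N 0)"
proof (intro bounded_moment_ext_eqI recurrence_extensionI)
  have lnz: "l (Suc i) \<noteq> 0" for i
    using nz l by simp
  show "shift_coeff l (Suc K) 0 \<noteq> 0"
    using shift_coeff_const[of l "Suc K div 2"] lnz K by simp
  show "shift_coeff l (Suc K) (Suc K) \<noteq> 0"
    using shift_coeff_lead lnz by blast
  \<comment> \<open>By \<open>sum_shift_coeff\<close> the left side is the entry at height
    \<open>Suc K\<close>, which vanishes for every \<open>N\<close>.\<close>
  show "(\<Sum>j\<le>Suc K. shift_coeff l (Suc K) j * height_seq K V l (N + int j) 0) = 0" for N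
    by (subst sum_shift_coeff[where K = K])
       (use lnz height_seq_step[of V l, OF nz l] height_seq_above[OF K] in auto)
qed (simp_all add: height_seq_def bounded_moment_eq_moment_to)

section \<open>Specialization to the indeterminates\<close>

lemma indet_nonzero: "indet i \<noteq> (0 :: 'c::idom ratfun)"
proof -
  have "Poly_Mapping.lookup (Poly_Mapping.single (Poly_Mapping.single i 1) (1 :: 'c))
      (Poly_Mapping.single i (1 :: nat)) \<noteq> 0"
    by (simp add: lookup_single)
  then have "Poly_Mapping.single (Poly_Mapping.single i (1 :: nat)) (1 :: 'c) \<noteq> 0"
    by (metis lookup_zero)
  then show ?thesis
    by (simp add: indet_def Zero_fract_def eq_fract)
qed

theorem theorem3p5:
  fixes V :: "nat \<Rightarrow> 'c::idom ratfun" and lam :: "nat \<Rightarrow> 'c ratfun" and n k :: nat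
  assumes "V = indet"
    and "\<And>i. i \<ge> 1 \<Longrightarrow> lam i = inverse (V (i - 1)) * inverse (V i)"
    and "n > 0" and "k > 0"
  shows "bounded_moment_ext (2 * k - 1) (\<lambda>_. 0) lam (- 2 * int n) =
    V 0 * (\<Sum>\<pi>\<in>PV2 (2 * k - 1) (2 * n - 1). seq_weight V \<pi>)"
proof -
  let ?K = "2 * k - 1"
  have "V i \<noteq> 0" for i
    using assms(1) indet_nonzero by simp
  moreover have "lam (Suc i) = inverse (V i) * inverse (V (Suc i))" for i
    using assms(2)[of "Suc i"] by simp
  moreover have "odd ?K"
    using \<open>k > 0\<close> by simp
  ultimately have "bounded_moment_ext ?K (\<lambda>_. 0) lam (- 2 * int n) =
      height_seq ?K V lam (- 2 * int n) 0"
    using bounded_moment_ext_eq_height_seq[of V lam ?K] by simp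
  \<comment> \<open>The gauge at height 0 is 1. Of the \<open>2 * n\<close> moves the last goes to
    the closing 0, leaving \<open>2 * n - 1\<close> entries.\<close>
  also have "\<dots> = pv_sum ?K V (Suc (2 * n - 1)) 0"
    using \<open>n > 0\<close> by (simp add: height_seq_def gauge_def nat_mult_distrib del: pv_sum.simps)
  also have "\<dots> = V 0 * (\<Sum>\<pi>\<in>PV2 ?K (2 * n - 1). seq_weight V \<pi>)"
    using \<open>n > 0\<close> by (subst pv_sum_eq_walks) (simp add: PV2_eq_pv_walks)
  finally show ?thesis .
qed

end
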